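(* Let $k\ge 10$ be an integer. Define the following ten sets of $k$-digit integers (in the digit-string notation explained in the context, where $d_{(n)}$ means the digit $d$ repeated $n$ times): \begin{align*} \mathcal{N}_{ka}=\{&10_{(k-1)},\,20_{(k-1)},\,30_{(k-1)},\,40_{(k-1)},\,50_{(k-1)},\,60_{(k-1)},\,70_{(k-1)},\,80_{(k-1)},\,90_{(k-1)}\},\\ \mathcal{N}_{kb}=\{&120_{(k-2)},\,180_{(k-2)},\,240_{(k-2)},\,270_{(k-2)},\,360_{(k-2)},\,450_{(k-2)},\,480_{(k-2)}\},\\ \mathcal{N}_{kc}=\{&1_{(3)}0_{(k-3)},\,2_{(3)}0_{(k-3)},\,3_{(3)}0_{(k-3)},\,4_{(3)}0_{(k-3)},\,5_{(3)}0_{(k-3)},\,6_{(3)}0_{(k-3)},\,7_{(3)}0_{(k-3)},\\ &8_{(3)}0_{(k-3)},\,9_{(3)}0_{(k-3)}\},\\ \mathcal{N}_{kd}=\{&1170_{(k-3)},\,1260_{(k-3)},\,1350_{(k-3)},\,1440_{(k-3)},\,2250_{(k-3)},\,2340_{(k-3)},\,2880_{(k-3)},\,4680_{(k-3)}\},\\ \mathcal{N}_{ke}=\{&1_{(3)}60_{(k-4)},\,11250_{(k-4)},\,11340_{(k-4)},\,12240_{(k-4)},\,12330_{(k-4)},\,2_{(3)}30_{(k-4)},\\ &24480_{(k-4)},\,22680_{(k-4)},\,24660_{(k-4)},\,36990_{(k-4)},\,4_{(3)}60_{(k-4)},\,6_{(3)}90_{(k-4)}\},\\ \mathcal{N}_{kf}=\{&1_{(4)}50_{(k-5)},\,1_{(3)}240_{(k-5)},\,1_{(3)}330_{(k-5)},\,112230_{(k-5)},\,12_{(4)}0_{(k-5)},\,2_{(3)}480_{(k-5)},\\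 &2_{(3)}660_{(k-5)},\,224460_{(k-5)},\,24_{(4)}0_{(k-5)},\,3_{(3)}990_{(k-5)},\,336690_{(k-5)},\,36_{(4)}0_{(k-5)},\,48_{(4)}0_{(k-5)}\},\\ \mathcal{N}_{kg}=\{&1_{(5)}40_{(k-6)},\,1_{(4)}230_{(k-6)},\,1_{(3)}2_{(3)}0_{(k-6)},\,2_{(5)}80_{(k-6)},\,2_{(4)}460_{(k-6)},\\ &2_{(3)}4_{(3)}0_{(k-6)},\,3_{(4)}690_{(k-6)},\,3_{(3)}6_{(3)}0_{(k-6)},\,4_{(3)}8_{(3)}0_{(k-6)}\},\\ \mathcal{N}_{kh}=\{&1_{(6)}30_{(k-7)},\,1_{(5)}220_{(k-7)},\,2_{(6)}60_{(k-7)},\,2_{(5)}440_{(k-7)},\,3_{(6)}90_{(k-7)},\,3_{(5)}660_{(k-7)},\,4_{(5)}880_{(k-7)}\},\\ \mathcal{N}_{ki}=\{&1_{(7)}20_{(k-8)},\,2_{(7)}40_{(k-8)},\,3_{(7)}60_{(k-8)},\,4_{(7)}80_{(k-8)}\},\\ \mathcal{N}_{kj}=\{&1_{(9)}0_{(k-9)},\,2_{(9)}0_{(k-9)},\,3_{(9)}0_{(k-9)},\,4_{(9)}0_{(k-9)},\,5_{(9)}0_{(k-9)},\,6_{(9)}0_{(k-9)},\,7_{(9)}0_{(k-9)},\\ &8_{(9)}0_{(k-9)},\,9_{(9)}0_{(k-9)}\}. \end{align*} Let $$\mathcal{N}_k=\mathcal{N}_{ka}\cup\mathcal{N}_{kb}\cup\mathcal{N}_{kc}\cup\mathcal{N}_{kd}\cup\mathcal{N}_{ke}\cup\mathcal{N}_{kf}\cup\mathcal{N}_{kg}\cup\mathcal{N}_{kh}\cup\mathcal{N}_{ki}\cup\mathcal{N}_{kj},$$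 and let $\mathrm{PINN}_k=\mathcal{S}_k\mathcal{N}_k$ be the set of all integers obtained from elements of $\mathcal{N}_k$ by permuting their $k$ decimal digits (leading zeros being omitted). Then every element of $\mathrm{PINN}_k$ is a permutation-invariant Niven number.
   Context: All numbers are written in base 10. A Niven number is a positive integer divisible by the sum of its decimal digits. Digit-string notation: a juxtaposition of digits denotes the decimal number with those digits, most significant first. For a digit $d$ and integer $n\ge 0$, $d_{(n)}$ denotes the block consisting of $d$ repeated $n$ times (empty if $n=0$); the subscript applies only to the single digit immediately before it. For example, $1_{(3)}=111$; $10_{(3)}=1000$; $1_{(3)}60_{(2)}=111600$; $12_{(4)}0=122220$; $112230_{(2)}=1122300$. Leading-zero convention: leading zeros in a digit string are omitted, i.e. $0_{(i-1)}a_i\ldots a_k=a_i\ldots a_k$ for $a_i\ne 0$. $\mathcal{S}_k$ is the symmetric group on $k$ elements, acting on $k$-digit strings $a_ka_{k-1}\cdots a_1$ by permuting the digit positions. For a set $\mathcal{N}$ of $k$-digit integers, $\mathcal{S}_k\mathcal{N}=\{s(A): s\in\mathcal{S}_k,\ A\in\mathcal{N}\}$, each resulting string being read as an integer with its leading zeros omitted. A permutation-invariant Niven number (PINN) is a positive integer for which every permutation of its decimal digits (leading zeros of the permuted string being omitted) yields a Niven number. *)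

theory Defs
  imports "HOL-Combinatorics.Permutations"
begin

(* Digit strings are lists of digits, most significant digit first, whereas horner_sum expects
   the least significant digit first.  Leading zeros of a string do not affect its value. *)

definition decimal :: "nat list \<Rightarrow> nat" where
  "decimal ds = horner_sum id 10 (rev ds)"

(* Without leading zeros; zero has the empty digit string. *)
fun digits :: "nat \<Rightarrow> nat list" where
  "digits n = (if n = 0 then [] else digits (n div 10) @ [n mod 10])"

declare digits.simps [simp del]

lemma decimal_append_single: "decimal (ds @ [d]) = 10 * decimal ds + d"
  by (simp add: decimal_def)

lemma decimal_digits: "decimal (digits n) = n"
proof (induction n rule: digits.induct)
  case (1 n)
  show ?case
  proof (cases "n = 0")
    case True
    then show ?thesis by (simp add: digits.simps[of 0] decimal_def)
  next
    case False
    with 1 show ?thesis by (subst digits.simps) (simp add: decimal_append_single)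
  qed
qed

definition niven :: "nat \<Rightarrow> bool" where
  "niven n \<longleftrightarrow> n > 0 \<and> sum_list (digits n) dvd n"

definition pinn :: "nat \<Rightarrow> bool" where
  "pinn n \<longleftrightarrow> n > 0 \<and>
     (\<forall>s. s permutes {..<length (digits n)} \<longrightarrow> niven (decimal (permute_list s (digits n))))"

(* The set S_k N, for a set N of k-digit numbers. *)
definition sym_orbit :: "nat \<Rightarrow> nat set \<Rightarrow> nat set" where
  "sym_orbit k N = {decimal (permute_list s (digits A)) | s A. s permutes {..<k} \<and> A \<in> N}"

abbreviation blk :: "nat \<Rightarrow> nat \<Rightarrow> nat list" where
  "blk d n \<equiv> replicate n d"

(* The numbers whose digit strings are those in W, each followed by z zeros. *)
definition with_zeros :: "nat \<Rightarrow> nat list set \<Rightarrow> nat set" where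
  "with_zeros z W = (\<lambda>w. decimal (w @ blk 0 z)) ` W"

definition N_a :: "nat \<Rightarrow> nat set" where
  "N_a k = with_zeros (k - 1) {[1], [2], [3], [4], [5], [6], [7], [8], [9]}"

definition N_b :: "nat \<Rightarrow> nat set" where
  "N_b k = with_zeros (k - 2) {[1,2], [1,8], [2,4], [2,7], [3,6], [4,5], [4,8]}"

definition N_c :: "nat \<Rightarrow> nat set" where
  "N_c k = with_zeros (k - 3)
     {blk 1 3, blk 2 3, blk 3 3, blk 4 3, blk 5 3, blk 6 3, blk 7 3, blk 8 3, blk 9 3}"

definition N_d :: "nat \<Rightarrow> nat set" where
  "N_d k = with_zeros (k - 3)
     {[1,1,7], [1,2,6], [1,3,5], [1,4,4], [2,2,5], [2,3,4], [2,8,8], [4,6,8]}"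

definition N_e :: "nat \<Rightarrow> nat set" where
  "N_e k = with_zeros (k - 4)
     {blk 1 3 @ [6], [1,1,2,5], [1,1,3,4], [1,2,2,4], [1,2,3,3], blk 2 3 @ [3],
      [2,4,4,8], [2,2,6,8], [2,4,6,6], [3,6,9,9], blk 4 3 @ [6], blk 6 3 @ [9]}"

definition N_f :: "nat \<Rightarrow> nat set" where
  "N_f k = with_zeros (k - 5)
     {blk 1 4 @ [5], blk 1 3 @ [2,4], blk 1 3 @ [3,3], [1,1,2,2,3], [1] @ blk 2 4,
      blk 2 3 @ [4,8], blk 2 3 @ [6,6], [2,2,4,4,6], [2] @ blk 4 4, blk 3 3 @ [9,9],
      [3,3,6,6,9], [3] @ blk 6 4, [4] @ blk 8 4}"

definition N_g :: "nat \<Rightarrow> nat set" where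
  "N_g k = with_zeros (k - 6)
     {blk 1 5 @ [4], blk 1 4 @ [2,3], blk 1 3 @ blk 2 3, blk 2 5 @ [8], blk 2 4 @ [4,6],
      blk 2 3 @ blk 4 3, blk 3 4 @ [6,9], blk 3 3 @ blk 6 3, blk 4 3 @ blk 8 3}"

definition N_h :: "nat \<Rightarrow> nat set" where
  "N_h k = with_zeros (k - 7)
     {blk 1 6 @ [3], blk 1 5 @ [2,2], blk 2 6 @ [6], blk 2 5 @ [4,4], blk 3 6 @ [9],
      blk 3 5 @ [6,6], blk 4 5 @ [8,8]}"

definition N_i :: "nat \<Rightarrow> nat set" where
  "N_i k = with_zeros (k - 8) {blk 1 7 @ [2], blk 2 7 @ [4], blk 3 7 @ [6], blk 4 7 @ [8]}"

definition N_j :: "nat \<Rightarrow> nat set" where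
  "N_j k = with_zeros (k - 9)
     {blk 1 9, blk 2 9, blk 3 9, blk 4 9, blk 5 9, blk 6 9, blk 7 9, blk 8 9, blk 9 9}"

definition N_all :: "nat \<Rightarrow> nat set" where
  "N_all k = N_a k \<union> N_b k \<union> N_c k \<union> N_d k \<union> N_e k \<union> N_f k \<union> N_g k \<union> N_h k \<union> N_i k \<union> N_j k"

definition PINN_set :: "nat \<Rightarrow> nat set" where
  "PINN_set k = sym_orbit k (N_all k)"

end

theory Submission
  imports Defs
begin

text \<open>
  Every digit string occurring in the ten families has a digit sum \<open>s\<close> that divides \<open>9 * g\<close>, where
  \<open>g\<close> is the greatest common divisor of its digits: dividing all digits by \<open>g\<close> leaves a string with
  digit sum 1, 3 or 9. This single condition explains the whole list. Since \<open>10 ^ i \<equiv> 1\<close> modulo 9,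
  a digit \<open>d\<close>, being a multiple of \<open>g\<close>, contributes the same to the value and to the digit sum
  modulo \<open>9 * g\<close>; hence value and digit sum agree modulo \<open>9 * g\<close>, in particular modulo \<open>s\<close>, so \<open>s\<close>
  divides the value (\<open>sum_dvd_decimal\<close>).

  The condition depends only on which nonzero digits occur, with their multiplicities. It is
  therefore stable under permuting the digits, under dropping leading zeros and under appending
  zeros, which is why it passes from the words listed in the families to all numbers in the orbit,
  and again to all permutations of the digits of those (\<open>pinn_if_balanced\<close>).
\<close>

definition balanced :: "nat list \<Rightarrow> bool" where
  "balanced ds \<longleftrightarrow> set ds \<subseteq> {..<10} \<and> 0 < sum_list ds \<and> sum_list ds dvd 9 * Gcd (set ds)"

lemma nine_dvd_power_ten_minus_one: "(9::nat) dvd 10 ^ n - 1"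
proof (induction n)
  case (Suc n)
  have "(10::nat) ^ Suc n - 1 = 9 * 10 ^ n + (10 ^ n - 1)"
    by simp
  with Suc show ?case
    by (metis dvd_add dvd_triv_left)
qed simp

lemma decimal_Cons: "decimal (d # ds) = d * 10 ^ length ds + decimal ds"
  by (simp add: decimal_def horner_sum_append)

text \<open>
  The difference of value and digit sum is the sum of the terms \<open>d * (10 ^ i - 1)\<close>, each of which
  is a multiple of \<open>g * 9\<close>.
\<close>

lemma decimal_eq_sum_plus_multiple:
  assumes "\<And>d. d \<in> set ds \<Longrightarrow> g dvd d"
  shows "\<exists>q. decimal ds = sum_list ds + 9 * g * q"
  using assms
proof (induction ds)
  case Nil
  show ?case by (simp add: decimal_def)
next
  case (Cons d ds)
  then obtain q where q: "decimal ds = sum_list ds + 9 * g * q"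
    by auto
  obtain a where a: "d = g * a"
    using Cons.prems by (auto elim: dvdE)
  obtain b where "(10::nat) ^ length ds - 1 = 9 * b"
    using nine_dvd_power_ten_minus_one by (auto elim: dvdE)
  then have "(10::nat) ^ length ds = 9 * b + 1"
    by (metis le_add_diff_inverse2 one_le_numeral one_le_power)
  then have "decimal (d # ds) = sum_list (d # ds) + 9 * g * (a * b + q)"
    by (simp add: decimal_Cons q a algebra_simps)
  then show ?case ..
qed

lemma sum_dvd_decimal:
  assumes "sum_list ds dvd 9 * Gcd (set ds)"
  shows "sum_list ds dvd decimal ds"
proof -
  obtain q where "decimal ds = sum_list ds + 9 * Gcd (set ds) * q"
    using decimal_eq_sum_plus_multiple[of ds "Gcd (set ds)"] by auto
  with assms show ?thesis
    by simp
qed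

lemma digits_decimal:
  assumes "set ds \<subseteq> {..<10}"
  shows "digits (decimal ds) = dropWhile (\<lambda>x. x = 0) ds"
  using assms
proof (induction ds rule: rev_induct)
  case Nil
  show ?case by (simp add: decimal_def digits.simps)
next
  case (snoc d ds)
  then have IH: "digits (decimal ds) = dropWhile (\<lambda>x. x = 0) ds" and "d < 10"
    by auto
  show ?case
  proof (cases "decimal ds = 0")
    case True
    \<comment> \<open>The string \<open>ds\<close> then consists of zeros only, so that \<open>d\<close> decides whether anything remains.\<close>
    with IH have "dropWhile (\<lambda>x. x = 0) ds = []"
      by (simp add: digits.simps[of 0])
    then have "\<forall>x \<in> set ds. x = 0"
      by simp
    with True \<open>d < 10\<close> show ?thesis
      by (simp add: decimal_append_single dropWhile_append2 digits.simps[of d] digits.simps[of 0])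
  next
    case False
    have "dropWhile (\<lambda>x. x = 0) ds \<noteq> []"
      using False IH by (subst IH[symmetric], subst digits.simps) simp
    then have "dropWhile (\<lambda>x. x = 0) (ds @ [d]) = dropWhile (\<lambda>x. x = 0) ds @ [d]"
      by (auto simp: dropWhile_append)
    with False \<open>d < 10\<close> IH show ?thesis
      by (subst digits.simps) (simp add: decimal_append_single)
  qed
qed

lemma balanced_mset_cong:
  assumes "mset xs = mset ys"
  shows "balanced xs \<longleftrightarrow> balanced ys"
  using mset_eq_setD[OF assms] arg_cong[OF assms, of sum_mset]
  by (simp add: balanced_def sum_mset_sum_list)

lemma balanced_Cons_zero: "balanced (0 # ds) \<longleftrightarrow> balanced ds"
  by (simp add: balanced_def)

lemma balanced_drop_leading_zeros: "balanced (dropWhile (\<lambda>x. x = 0) ds) \<longleftrightarrow> balanced ds"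
  by (induction ds) (auto simp: balanced_Cons_zero)

lemma balanced_append_zeros: "balanced (ds @ blk 0 n) \<longleftrightarrow> balanced ds"
proof -
  have "balanced (ds @ blk 0 n) \<longleftrightarrow> balanced (blk 0 n @ ds)"
    by (rule balanced_mset_cong) simp
  also have "\<dots> \<longleftrightarrow> balanced ds"
    by (induction n) (simp_all add: balanced_Cons_zero)
  finally show ?thesis .
qed

lemma balanced_digits_decimal:
  assumes "balanced ds"
  shows "balanced (digits (decimal ds))"
  using assms digits_decimal[of ds] balanced_drop_leading_zeros[of ds]
  by (simp add: balanced_def)

lemma balanced_permute_list:
  assumes "s permutes {..<length ds}" "balanced ds"
  shows "balanced (permute_list s ds)"
  using assms balanced_mset_cong[of "permute_list s ds" ds] by simp

lemma pos_if_balanced: "balanced (digits n) \<Longrightarrow> 0 < n"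
  by (cases n) (simp_all add: balanced_def digits.simps[of 0])

lemma niven_if_balanced:
  assumes "balanced (digits n)"
  shows "niven n"
  using assms pos_if_balanced sum_dvd_decimal[of "digits n"]
  by (simp add: niven_def balanced_def decimal_digits)

lemma pinn_if_balanced:
  assumes "balanced (digits n)"
  shows "pinn n"
  using assms pos_if_balanced
  by (auto simp: pinn_def intro!: niven_if_balanced balanced_digits_decimal balanced_permute_list)

text \<open>
  Exact length \<open>k\<close> matters: the orbit permutes the positions below \<open>k\<close>, and only if these are all
  positions of the digit string is the permuted string a rearrangement of it. The leading digit of
  \<open>w\<close> must be nonzero for the same reason.
\<close>

lemma with_zeros_balanced:
  assumes "A \<in> with_zeros (k - m) W" "m \<le> k"
    and "\<forall>w \<in> W. length w = m \<and> hd w \<noteq> 0 \<and> balanced w"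
  shows "length (digits A) = k \<and> balanced (digits A)"
proof -
  obtain w where w: "A = decimal (w @ blk 0 (k - m))" "length w = m" "hd w \<noteq> 0" "balanced w"
    using assms(1,3) by (auto simp: with_zeros_def)
  then have b: "balanced (w @ blk 0 (k - m))"
    by (simp add: balanced_append_zeros)
  have "w \<noteq> []"
    using w by (auto simp: balanced_def)
  then have "dropWhile (\<lambda>x. x = 0) (w @ blk 0 (k - m)) = w @ blk 0 (k - m)"
    using w by (cases w) auto
  then have "digits A = w @ blk 0 (k - m)"
    using b w digits_decimal[of "w @ blk 0 (k - m)"] by (simp add: balanced_def)
  with b w assms(2) show ?thesis
    by simp
qed

lemma N_all_balanced:
  assumes "k \<ge> 10" "A \<in> N_all k"
  shows "length (digits A) = k \<and> balanced (digits A)"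
proof -
  consider "A \<in> N_a k" | "A \<in> N_b k" | "A \<in> N_c k" | "A \<in> N_d k" | "A \<in> N_e k"
    | "A \<in> N_f k" | "A \<in> N_g k" | "A \<in> N_h k" | "A \<in> N_i k" | "A \<in> N_j k"
    using assms(2) by (auto simp: N_all_def)
  then show ?thesis
    by cases
      (unfold N_a_def N_b_def N_c_def N_d_def N_e_def N_f_def N_g_def N_h_def N_i_def N_j_def,
       (erule with_zeros_balanced;
        use assms(1) in \<open>simp add: balanced_def sum_list_replicate gcd_non_0_nat
          numeral_3_eq_3[symmetric]\<close>)+)
qed

theorem theorem1:
  fixes k :: nat
  assumes "k \<ge> 10"
  shows "\<forall>n \<in> PINN_set k. pinn n"
proof
  fix n
  assume "n \<in> PINN_set k"
  then obtain s A where n: "n = decimal (permute_list s (digits A))"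
    and "s permutes {..<k}" "A \<in> N_all k"
    by (auto simp: PINN_set_def sym_orbit_def)
  with N_all_balanced[OF assms, of A] have "balanced (permute_list s (digits A))"
    by (simp add: balanced_permute_list)
  then show "pinn n"
    unfolding n by (intro pinn_if_balanced balanced_digits_decimal)
qed

end
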